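(* Let $T_0:\Omega_0\to\mathbb{R}$ and $f$ be given, where $f(y,t)$ is a smooth function defined for $t\ge 0$, $y\in\Omega(t)$. Consider the problem in the moving domain $$\frac{\partial T}{\partial t}(y,t)+\operatorname{div}_y\big(T(y,t)\vec{V}(y)\big)=f(y,t),\quad y\in\Omega(t);\qquad T(y,t)=0,\quad y\in\partial\Omega(t),\ \forall t;\qquad T(y,0)=T_0(y),\quad y\in\Omega_0,$$ and the problem in the fixed domain $$\frac{\partial\overline{T}}{\partial t}(x,t)+\overline{T}(x,t)\,\overline{\operatorname{div}\vec{V}}(x,t)=\overline{f}(x,t),\quad x\in\Omega_0;\qquad \overline{T}(x,t)=0,\quad x\in\partial\Omega_0,\ \forall t;\qquad \overline{T}(x,0)=T_0(x),\quad x\in\Omega_0.$$ Then each of the two problems has a unique solution, given explicitly by $$T(y,t)=T_0(x)\,e^{-\int_0^t\operatorname{div}\vec{V}(\phi(r)x)\,dr}+\int_0^t e^{-\int_s^t\operatorname{div}\vec{V}(\phi(r)x)\,dr}\,f(\phi(s)x,s)\,ds,\qquad y=\phi(t)x\in\Omega(t),$$ and $$\overline{T}(x,t)=T_0(x)\,e^{-\int_0^t\operatorname{div}\vec{V}(\phi(r)x)\,dr}+\int_0^t e^{-\int_s^t\operatorname{div}\vec{V}(\phi(r)x)\,dr}\,\overline{f}(x,s)\,ds,\qquad x\in\Omega_0,$$ respectively.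
   Context: $\Omega_0\subset\mathbb{R}^n$ is a smooth open set (domain). $\vec{V}:\mathbb{R}^n\to\mathbb{R}^n$ is a smooth vector field such that all solutions of the autonomous ODE $\dot Y=\vec{V}(Y)$ are defined for all $t\in\mathbb{R}$. For $t\in\mathbb{R}$, $\phi(t):\mathbb{R}^n\to\mathbb{R}^n$ is the flow map: $\phi(t)x=Y(t;x)$, where $Y(\cdot;x)$ is the solution with $Y(0;x)=x$. The moving domain is $\Omega(t)=\phi(t)\Omega_0$, with $\partial\Omega(t)=\phi(t)\partial\Omega_0$. For a function $g(y,t)$ defined for $y\in\Omega(t)$ (or its closure), the pulled-back function is $\overline{g}(x,t)=g(\phi(t)x,t)$; so $\overline{\operatorname{div}\vec{V}}(x,t)=(\operatorname{div}\vec{V})(\phi(t)x)$. Notion of solution: a solution of the fixed-domain problem is a function $\overline{T}:\overline{\Omega_0}\times[0,\infty)\to\mathbb{R}$ such that $t\mapsto\overline{T}(x,t)$ is $C^1$ on $[0,\infty)$ for each $x\in\Omega_0$ and which satisfies the equation pointwise in $\Omega_0$, the boundary values on $\partial\Omega_0$ and the initial condition; no continuity in $x$ up to the boundary is imposed. By definition, a function $T(y,t)$ is a solution of the moving-domain problem if and only if its pull-back $\overline{T}(x,t)=T(\phi(t)x,t)$ is a solution of the fixed-domain problem. *)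

theory Defs
  imports "HOL-Analysis.Analysis"
begin

text \<open>\<open>Ck_on k U g\<close> is meant for open \<open>U\<close> only: it uses the two-sided derivative \<open>at x\<close>. Asking for
  all directional derivatives amounts to asking for all partial derivatives up to order \<open>k\<close>.\<close>

fun Ck_on :: "nat \<Rightarrow> 'a::euclidean_space set \<Rightarrow> ('a \<Rightarrow> 'b::euclidean_space) \<Rightarrow> bool" where
  "Ck_on 0 U g \<longleftrightarrow> continuous_on U g"
| "Ck_on (Suc k) U g \<longleftrightarrow>
     (\<forall>x\<in>U. g differentiable (at x)) \<and>
     (\<forall>v. Ck_on k U (\<lambda>x. frechet_derivative g (at x) v))"

text \<open>Smoothness on an arbitrary set means local extendability to smooth functions on open sets;
  for open \<open>S\<close> this is the usual notion. The general case is needed for functions of \<open>(y, t)\<close>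
  with \<open>t \<ge> 0\<close>, whose domain is not open.\<close>

definition smooth_on :: "'a::euclidean_space set \<Rightarrow> ('a \<Rightarrow> 'b::euclidean_space) \<Rightarrow> bool" where
  "smooth_on S f \<longleftrightarrow>
     (\<forall>p\<in>S. \<exists>U g. open U \<and> p \<in> U \<and> (\<forall>k. Ck_on k U g) \<and> (\<forall>q\<in>S \<inter> U. g q = f q))"

text \<open>Near each boundary point the set is the negativity set of a smooth function with nonvanishing
  gradient there, i.e. it lies locally on one side of a smooth hypersurface.\<close>

definition smooth_open_set :: "'a::euclidean_space set \<Rightarrow> bool" where
  "smooth_open_set \<Omega> \<longleftrightarrow>
     open \<Omega> \<and>
     (\<forall>p\<in>frontier \<Omega>. \<exists>U (\<rho> :: 'a \<Rightarrow> real).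
        open U \<and> p \<in> U \<and> smooth_on U \<rho> \<and>
        frechet_derivative \<rho> (at p) \<noteq> (\<lambda>v. 0) \<and>
        \<Omega> \<inter> U = {x \<in> U. \<rho> x < 0})"

definition divergence :: "('a::euclidean_space \<Rightarrow> 'a) \<Rightarrow> 'a \<Rightarrow> real" where
  "divergence V y = (\<Sum>b\<in>Basis. frechet_derivative V (at y) b \<bullet> b)"

definition global_solution :: "('a::euclidean_space \<Rightarrow> 'a) \<Rightarrow> 'a \<Rightarrow> (real \<Rightarrow> 'a) \<Rightarrow> bool" where
  "global_solution V x Y \<longleftrightarrow>
     Y 0 = x \<and> (\<forall>t. (Y has_vector_derivative V (Y t)) (at t))"

definition complete_field :: "('a::euclidean_space \<Rightarrow> 'a) \<Rightarrow> bool" where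
  "complete_field V \<longleftrightarrow> (\<forall>x. \<exists>Y. global_solution V x Y)"

text \<open>For smooth complete \<open>V\<close> the solution with \<open>Y 0 = x\<close> exists and is unique, so the description
  is well defined.\<close>

definition flow :: "('a::euclidean_space \<Rightarrow> 'a) \<Rightarrow> real \<Rightarrow> 'a \<Rightarrow> 'a" where
  "flow V t x = (THE Y. global_solution V x Y) t"

definition moving_domain :: "('a::euclidean_space \<Rightarrow> 'a) \<Rightarrow> 'a set \<Rightarrow> real \<Rightarrow> 'a set" where
  "moving_domain V \<Omega>\<^sub>0 t = flow V t ` \<Omega>\<^sub>0"

definition pullback ::
  "('a::euclidean_space \<Rightarrow> 'a) \<Rightarrow> ('a \<Rightarrow> real \<Rightarrow> real) \<Rightarrow> 'a \<Rightarrow> real \<Rightarrow> real" where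
  "pullback V g x t = g (flow V t x) t"

text \<open>Solutions of \<open>\<partial>T/\<partial>t + a T = h\<close> in \<open>\<Omega>\<^sub>0\<close> with zero boundary values and initial value \<open>T0\<close>.
  \<open>T'\<close> is the continuous time derivative (one-sided at \<open>t = 0\<close>). Only the values of \<open>T\<close> on
  \<open>closure \<Omega>\<^sub>0 \<times> [0,\<infinity>)\<close> matter, and no regularity in \<open>x\<close> is required.\<close>

definition fixed_domain_solution ::
  "'a::euclidean_space set \<Rightarrow> ('a \<Rightarrow> real \<Rightarrow> real) \<Rightarrow> ('a \<Rightarrow> real \<Rightarrow> real) \<Rightarrow> ('a \<Rightarrow> real) \<Rightarrow>
   ('a \<Rightarrow> real \<Rightarrow> real) \<Rightarrow> bool" where
  "fixed_domain_solution \<Omega>\<^sub>0 a h T0 T \<longleftrightarrow>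
     (\<forall>x\<in>\<Omega>\<^sub>0. \<exists>T'. continuous_on {0..} T' \<and>
        (\<forall>t\<ge>0. (T x has_real_derivative T' t) (at t within {0..}) \<and>
                T' t + T x t * a x t = h x t)) \<and>
     (\<forall>x\<in>frontier \<Omega>\<^sub>0. \<forall>t\<ge>0. T x t = 0) \<and>
     (\<forall>x\<in>\<Omega>\<^sub>0. T x 0 = T0 x)"

text \<open>Solutions of \<open>\<partial>T/\<partial>t + div (T V) = f\<close> in the moving domain are by definition the functions
  whose pull-back solves the fixed-domain problem: along the flow,
  \<open>\<partial>T/\<partial>t + div (T V) = \<partial>T/\<partial>t + V \<bullet> \<nabla>T + T div V\<close> becomes
  \<open>d/dt T(\<phi>(t)x, t) + T(\<phi>(t)x, t) (div V)(\<phi>(t)x)\<close>. In particular \<open>T\<close> itself need not be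
  differentiable in space. Since \<open>\<phi>(t)\<close> maps \<open>frontier \<Omega>\<^sub>0\<close> onto
  \<open>frontier (moving_domain V \<Omega>\<^sub>0 t)\<close>, the boundary condition says that \<open>T\<close> vanishes there.\<close>

definition moving_domain_solution ::
  "'a::euclidean_space set \<Rightarrow> ('a \<Rightarrow> 'a) \<Rightarrow> ('a \<Rightarrow> real \<Rightarrow> real) \<Rightarrow> ('a \<Rightarrow> real) \<Rightarrow>
   ('a \<Rightarrow> real \<Rightarrow> real) \<Rightarrow> bool" where
  "moving_domain_solution \<Omega>\<^sub>0 V f T0 T \<longleftrightarrow>
     fixed_domain_solution \<Omega>\<^sub>0 (pullback V (\<lambda>y t. divergence V y)) (pullback V f) T0
       (pullback V T)"

end

theory Submission
  imports Defs
begin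

text \<open>For fixed \<open>x\<close> the fixed-domain problem is a linear scalar ODE in \<open>t\<close>, and the integrating factor
  \<open>exp (\<integral>\<^sub>0\<^sup>t div V (\<phi>(r) x) dr)\<close> gives existence, uniqueness and the formula. Pulling back by the flow
  turns this into the statement in the moving domain. Uniqueness there up to the boundary needs
  that \<open>\<phi>(t)\<close> maps \<open>closure \<Omega>\<^sub>0\<close> onto \<open>closure (\<Omega>(t))\<close>, i.e. that the flow depends
  continuously on the initial point; this follows from Gronwall's inequality for \<open>V\<close> and for the
  reversed field \<open>-V\<close>.\<close>

section \<open>Smooth functions\<close>

text \<open>Continuity passes from the local extension \<open>g\<close> to \<open>f\<close>, as both
  agree on \<open>S\<close> near the point. \<open>S\<close> need not be open: the lemma is applied
  to the space-time set with \<open>t\<close> \<ge> 0 on which the source term lives.\<close>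

lemma smooth_on_imp_continuous_on:
  assumes "smooth_on S f"
  shows "continuous_on S f"
  unfolding continuous_on_eq_continuous_within
proof
  fix p assume p: "p \<in> S"
  obtain U g where U: "open U" "p \<in> U" "\<forall>k. Ck_on k U g" "\<forall>q\<in>S \<inter> U. g q = f q"
    using assms p unfolding smooth_on_def by meson
  have "continuous_on U g"
    using U(3)[rule_format, of 0] by simp
  then have "continuous (at p within S) g"
    using U(1,2) by (meson continuous_at_imp_continuous_at_within continuous_on_eq_continuous_at)
  moreover have "\<forall>\<^sub>F q in at p within S. g q = f q"
    using U(1,2,4) unfolding eventually_at_topological by auto
  ultimately show "continuous (at p within S) f"
    using U(2,4) p by (simp add: continuous_within Lim_transform_eventually)
qed

text \<open>\<open>V\<close> equals the extension \<open>g\<close> on a whole open neighbourhood, so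
  their derivatives coincide there too, and continuity of the directional derivatives carries over
  from \<open>g\<close>.\<close>

lemma smooth_on_UNIV_imp_C1:
  fixes V :: "'a::euclidean_space \<Rightarrow> 'b::euclidean_space"
  assumes "smooth_on UNIV V"
  shows "V differentiable (at x)"
    and "continuous_on UNIV (\<lambda>x. frechet_derivative V (at x) v)"
proof -
  have *: "V differentiable (at p) \<and> isCont (\<lambda>x. frechet_derivative V (at x) v) p" for p
  proof -
    obtain U g where U: "open U" "p \<in> U" "\<forall>k. Ck_on k U g" "\<forall>q\<in>U. g q = V q"
      using assms unfolding smooth_on_def by (metis Int_UNIV_left UNIV_I)
    have g: "\<forall>x\<in>U. g differentiable (at x)" "continuous_on U (\<lambda>x. frechet_derivative g (at x) v)"
      using U(3)[rule_format, of 1] by simp_all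
    have V: "(V has_derivative frechet_derivative g (at q)) (at q)" if "q \<in> U" for q
      using has_derivative_transform_within_open[OF _ U(1) that, of g] g(1) U(4) that
      by (simp add: frechet_derivative_works)
    then have eq: "frechet_derivative V (at q) = frechet_derivative g (at q)" if "q \<in> U" for q
      using frechet_derivative_at that by metis
    have "continuous_on U (\<lambda>x. frechet_derivative V (at x) v)"
      using g(2) by (simp add: eq cong: continuous_on_cong)
    then show ?thesis
      using V U(1,2) by (auto simp: differentiable_def continuous_on_eq_continuous_at)
  qed
  show "V differentiable (at x)"
    using * by blast
  show "continuous_on UNIV (\<lambda>x. frechet_derivative V (at x) v)"
    using * by (simp add: continuous_on_eq_continuous_at)
qed

lemma smooth_on_UNIV_imp_continuous_divergence:
  assumes "smooth_on UNIV V"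
  shows "continuous_on UNIV (divergence V)"
  unfolding divergence_def
  by (intro continuous_intros smooth_on_UNIV_imp_C1(2)[OF assms])

text \<open>The derivative is bounded on the compact ball, and the ball is convex, so the mean value
  inequality applies. The constant may grow with \<open>R\<close>.\<close>

lemma smooth_on_UNIV_imp_lipschitz_on_cball:
  fixes V :: "'a::euclidean_space \<Rightarrow> 'b::euclidean_space"
  assumes "smooth_on UNIV V"
  shows "\<exists>L. L-lipschitz_on (cball 0 R) V"
proof -
  define F where "F = (\<lambda>x. frechet_derivative V (at x))"
  have der: "(V has_derivative F x) (at x)" for x
    using smooth_on_UNIV_imp_C1(1)[OF assms] unfolding F_def frechet_derivative_works .
  \<comment> \<open>\<open>N\<close> bounds the operator norm of the derivative and is visibly
    continuous, since it involves only finitely many directional derivatives.\<close>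
  define N where "N x = (\<Sum>b\<in>Basis. norm (F x b))" for x
  have "continuous_on UNIV N"
    unfolding N_def F_def by (intro continuous_intros smooth_on_UNIV_imp_C1(2)[OF assms])
  then have "bounded (N ` cball 0 R)"
    by (meson compact_cball compact_continuous_image compact_imp_bounded continuous_on_subset
        subset_UNIV)
  then obtain B where B: "B > 0" "\<And>x. x \<in> cball 0 R \<Longrightarrow> N x \<le> B"
    unfolding bounded_pos by (force simp: abs_le_iff)
  have "onorm (F x) \<le> B" if "x \<in> cball 0 R" for x
  proof (rule onorm_le)
    fix v
    have lin: "linear (F x)"
      using der has_derivative_linear by blast
    have "F x v = F x (\<Sum>b\<in>Basis. (v \<bullet> b) *\<^sub>R b)"
      by (simp add: euclidean_representation)
    also have "\<dots> = (\<Sum>b\<in>Basis. (v \<bullet> b) *\<^sub>R F x b)"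
      by (simp add: linear_sum[OF lin] linear_cmul[OF lin])
    finally have "norm (F x v) \<le> (\<Sum>b\<in>Basis. norm ((v \<bullet> b) *\<^sub>R F x b))"
      by (simp only: norm_sum)
    also have "\<dots> \<le> (\<Sum>b\<in>Basis. norm v * norm (F x b))"
      by (intro sum_mono) (simp add: Basis_le_norm mult_right_mono)
    also have "\<dots> = N x * norm v"
      by (simp add: N_def sum_distrib_left mult.commute)
    also have "\<dots> \<le> B * norm v"
      using B(2)[OF that] by (simp add: mult_right_mono)
    finally show "norm (F x v) \<le> B * norm v" .
  qed
  then have "B-lipschitz_on (cball 0 R) V"
    using B(1) der by (intro bounded_derivative_imp_lipschitz[where f' = F])
      (auto intro: has_derivative_at_withinI)
  then show ?thesis ..
qed

section \<open>The flow\<close>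

lemma global_solution_continuous:
  assumes "global_solution V x Y"
  shows "continuous_on S Y"
  using assms
  by (auto simp: global_solution_def
      intro!: continuous_at_imp_continuous_on has_vector_derivative_continuous)

lemma global_solution_shift:
  assumes "global_solution V x Y"
  shows "global_solution V (Y a) (\<lambda>t. Y (t + a))"
proof -
  have "((Y \<circ> (\<lambda>t. t + a)) has_vector_derivative 1 *\<^sub>R V (Y (t + a))) (at t)" for t
    using assms unfolding global_solution_def
    by (intro vector_diff_chain_at) (auto intro!: derivative_eq_intros)
  then show ?thesis
    by (simp add: global_solution_def o_def)
qed

text \<open>Time reversal reduces every claim about negative times to one about nonnegative times
  for the field \<open>- V\<close>.\<close>

lemma global_solution_reverse:
  assumes "global_solution V x Y"
  shows "global_solution (\<lambda>y. - V y) x (\<lambda>t. Y (- t))"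
proof -
  have "((Y \<circ> uminus) has_vector_derivative (- 1) *\<^sub>R V (Y (- t))) (at t)" for t
    using assms unfolding global_solution_def
    by (intro vector_diff_chain_at) (auto intro!: derivative_eq_intros)
  then show ?thesis
    using assms by (simp add: global_solution_def o_def)
qed

section \<open>Gronwall's inequality and dependence on the initial value\<close>

lemma gronwall_norm:
  fixes D :: "real \<Rightarrow> 'a::real_inner"
  assumes "0 \<le> t" "continuous_on {0..t} D"
    and der: "\<And>s. 0 < s \<Longrightarrow> s < t \<Longrightarrow> (D has_vector_derivative D' s) (at s)"
    and bound: "\<And>s. 0 < s \<Longrightarrow> s < t \<Longrightarrow> norm (D' s) \<le> L * norm (D s)"
  shows "norm (D t) \<le> norm (D 0) * exp (L * t)"
proof -
  \<comment> \<open>The squared norm stays differentiable where \<open>D\<close> vanishes; its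
    weight is chosen so that Cauchy-Schwarz and the bound on \<open>D'\<close> make \<open>g\<close>
    nonincreasing.\<close>
  define g where "g s = (D s \<bullet> D s) * exp (- 2 * L * s)" for s
  have "g t \<le> g 0"
  proof (rule DERIV_nonpos_imp_decreasing_open[OF assms(1)])
    fix s assume s: "0 < s" "s < t"
    have "((\<lambda>s. D s \<bullet> D s) has_derivative (\<lambda>h. D s \<bullet> (h *\<^sub>R D' s) + (h *\<^sub>R D' s) \<bullet> D s)) (at s)"
      using der[OF s] unfolding has_vector_derivative_def by (intro has_derivative_inner)
    then have "((\<lambda>s. D s \<bullet> D s) has_real_derivative 2 * (D s \<bullet> D' s)) (at s)"
      unfolding has_field_derivative_def
      by (rule has_derivative_eq_rhs) (auto simp: inner_commute)
    then have "(g has_real_derivative 2 * (D s \<bullet> D' s - L * (D s \<bullet> D s)) * exp (- 2 * L * s)) (at s)"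
      unfolding g_def by (auto intro!: derivative_eq_intros simp: algebra_simps)
    moreover have "D s \<bullet> D' s \<le> L * (D s \<bullet> D s)"
    proof -
      have "D s \<bullet> D' s \<le> norm (D s) * norm (D' s)"
        by (rule norm_cauchy_schwarz)
      also have "\<dots> \<le> norm (D s) * (L * norm (D s))"
        using bound[OF s] by (intro mult_left_mono) auto
      finally show ?thesis
        by (simp add: dot_square_norm power2_eq_square mult_ac)
    qed
    ultimately show "\<exists>y. (g has_real_derivative y) (at s) \<and> y \<le> 0"
      by (intro exI[of _ "2 * (D s \<bullet> D' s - L * (D s \<bullet> D s)) * exp (- 2 * L * s)"])
        (simp add: mult_nonpos_nonneg)
  next
    show "continuous_on {0..t} g"
      unfolding g_def by (intro continuous_intros assms(2))
  qed
  then have "D t \<bullet> D t \<le> (D 0 \<bullet> D 0) * exp (2 * L * t)"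
    by (simp add: g_def exp_minus field_simps)
  also have "\<dots> = (norm (D 0) * exp (L * t))\<^sup>2"
    by (simp add: dot_square_norm power_mult_distrib exp_double mult.assoc)
  finally have "(norm (D t))\<^sup>2 \<le> (norm (D 0) * exp (L * t))\<^sup>2"
    by (simp only: dot_square_norm)
  then show ?thesis
    by (rule power2_le_imp_le) simp
qed

text \<open>Gronwall's inequality needs a Lipschitz constant valid along both solutions, but
  \<open>V\<close> is Lipschitz only on balls. A bootstrap keeps \<open>Z\<close> within distance 1
  of the reference solution, hence in a fixed ball. The constant \<open>L\<close> is independent of
  \<open>z\<close> and \<open>Z\<close>, which is what continuity in the initial point
  requires.\<close>

lemma global_solutions_stay_close:
  fixes V :: "'a::euclidean_space \<Rightarrow> 'a"
  assumes lip: "\<And>R. \<exists>L. L-lipschitz_on (cball 0 R) V"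
    and Y: "global_solution V x Y" and "0 \<le> t"
  shows "\<exists>L. \<forall>z Z. global_solution V z Z \<longrightarrow> norm (z - x) * exp (L * t) < 1 \<longrightarrow>
    norm (Z t - Y t) \<le> norm (z - x) * exp (L * t)"
proof -
  have "bounded (Y ` {0..t})"
    using Y by (intro compact_imp_bounded compact_continuous_image global_solution_continuous) auto
  then obtain B where B: "\<And>s. 0 \<le> s \<Longrightarrow> s \<le> t \<Longrightarrow> norm (Y s) \<le> B"
    unfolding bounded_iff by force
  \<comment> \<open>The margin 1 around the reference orbit leaves room for every \<open>Z\<close>
    at distance less than 1 from it.\<close>
  obtain L where L: "L-lipschitz_on (cball 0 (B + 1)) V"
    using lip by blast
  then have "0 \<le> L"
    by (rule lipschitz_on_nonneg)
  show ?thesis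
  proof (intro exI allI impI)
    fix z Z assume Z: "global_solution V z Z" and small: "norm (z - x) * exp (L * t) < 1"
    define d where "d s = norm (Z s - Y s)" for s
    have contD: "continuous_on S (\<lambda>s. Z s - Y s)" for S
      using Y Z by (intro continuous_intros global_solution_continuous)
    have d0: "d 0 = norm (z - x)"
      using Y Z by (simp add: d_def global_solution_def)
    \<comment> \<open>Closeness is assumed only at times strictly before \<open>s\<close>, so that
      the estimate can be used at the first exit time itself.\<close>
    have est: "d s \<le> norm (z - x) * exp (L * t)"
      if "0 \<le> s" "s \<le> t" and less: "\<And>r. 0 \<le> r \<Longrightarrow> r < s \<Longrightarrow> d r < 1" for s
    proof -
      have "norm (Z s - Y s) \<le> norm (Z 0 - Y 0) * exp (L * s)"
      proof (rule gronwall_norm[OF \<open>0 \<le> s\<close> contD, where D' = "\<lambda>r. V (Z r) - V (Y r)"])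
        fix r assume r: "0 < r" "r < s"
        show "((\<lambda>r. Z r - Y r) has_vector_derivative V (Z r) - V (Y r)) (at r)"
          using Y Z unfolding global_solution_def by (intro has_vector_derivative_diff) auto
        have "norm (Y r) \<le> B" "norm (Z r - Y r) < 1"
          using B[of r] less[of r] r \<open>s \<le> t\<close> by (auto simp: d_def)
        then have "norm (Y r) \<le> B + 1" "norm (Z r) \<le> B + 1"
          using norm_triangle_sub[of "Z r" "Y r"] by linarith+
        then show "norm (V (Z r) - V (Y r)) \<le> L * norm (Z r - Y r)"
          using lipschitz_onD[OF L, of "Z r" "Y r"] by (simp add: dist_norm)
      qed
      also have "\<dots> \<le> norm (z - x) * exp (L * t)"
        using d0 \<open>0 \<le> L\<close> \<open>s \<le> t\<close> by (auto simp: d_def intro!: mult_left_mono)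
      finally show ?thesis
        by (simp add: d_def)
    qed
    have "d s < 1" if "0 \<le> s" "s \<le> t" for s
    proof (rule ccontr)
      assume "\<not> d s < 1"
      \<comment> \<open>If the distance ever reached 1, there would be a least such time
        \<open>m\<close>, because \<open>C\<close> is compact. Before \<open>m\<close> the distance
        is below 1, so \<open>est\<close> bounds \<open>d m\<close> by a quantity less than 1, a
        contradiction.\<close>
      define C where "C = {r \<in> {0..t}. 1 \<le> d r}"
      have "closed C"
        using continuous_closed_preimage[OF continuous_on_norm[OF contD[of "{0..t}"]]
            closed_atLeastAtMost closed_atLeast[of 1]]
        by (simp add: C_def d_def vimage_def Int_def)
      then have "compact C"
        unfolding C_def by (intro compact_eq_bounded_closed[THEN iffD2] conjI)
          (auto intro: bounded_subset[OF bounded_closed_interval[of 0 t]])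
      moreover have "C \<noteq> {}"
        using that \<open>\<not> d s < 1\<close> by (auto simp: C_def)
      ultimately obtain m where m: "m \<in> C" "\<And>r. r \<in> C \<Longrightarrow> m \<le> r"
        using compact_attains_inf[of C] by auto
      have "d m \<le> norm (z - x) * exp (L * t)"
      proof (rule est)
        show "d r < 1" if "0 \<le> r" "r < m" for r
          using m(1) m(2)[of r] that by (force simp: C_def)
      qed (use m(1) in \<open>auto simp: C_def\<close>)
      then show False
        using m(1) small by (auto simp: C_def)
    qed
    then show "norm (Z t - Y t) \<le> norm (z - x) * exp (L * t)"
      using est[of t] \<open>0 \<le> t\<close> by (simp add: d_def)
  qed
qed

text \<open>This is the case \<open>z = x\<close> of the previous estimate: the smallness condition
  reads 0 < 1 and the bound is 0.\<close>

lemma global_solution_unique_nonneg: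
  fixes V :: "'a::euclidean_space \<Rightarrow> 'a"
  assumes lip: "\<And>R. \<exists>L. L-lipschitz_on (cball 0 R) V"
    and Y: "global_solution V x Y" and Z: "global_solution V x Z" and "0 \<le> t"
  shows "Z t = Y t"
proof -
  obtain L where "\<forall>z Z. global_solution V z Z \<longrightarrow> norm (z - x) * exp (L * t) < 1 \<longrightarrow>
      norm (Z t - Y t) \<le> norm (z - x) * exp (L * t)"
    using global_solutions_stay_close[OF lip Y \<open>0 \<le> t\<close>] ..
  from this[rule_format, OF Z] show ?thesis
    by simp
qed

lemma global_solution_unique:
  fixes V :: "'a::euclidean_space \<Rightarrow> 'a"
  assumes lip: "\<And>R. \<exists>L. L-lipschitz_on (cball 0 R) V"
    and Y: "global_solution V x Y" and Z: "global_solution V x Z"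
  shows "Z = Y"
proof
  fix t :: real
  show "Z t = Y t"
  proof (cases "0 \<le> t")
    case True
    then show ?thesis
      by (rule global_solution_unique_nonneg[OF lip Y Z])
  next
    case False
    have "\<exists>L. L-lipschitz_on (cball 0 R) (\<lambda>y. - V y)" for R
      using lip[of R] lipschitz_on_minus by blast
    from global_solution_unique_nonneg[OF this global_solution_reverse[OF Y]
        global_solution_reverse[OF Z], of "- t"] False
    show ?thesis
      by simp
  qed
qed

section \<open>Group law and spatial continuity of the flow\<close>

locale complete_lipschitz_field =
  fixes V :: "'a::euclidean_space \<Rightarrow> 'a"
  assumes lipschitz: "\<And>R. \<exists>L. L-lipschitz_on (cball 0 R) V"
    and complete: "complete_field V"
begin

lemma flow_eq:
  assumes "global_solution V x Y"
  shows "flow V t x = Y t"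
proof -
  have "(THE Y. global_solution V x Y) = Y"
    using assms global_solution_unique[OF lipschitz assms] by (rule the_equality)
  then show ?thesis
    by (simp add: flow_def)
qed

lemma global_solution_flow: "global_solution V x (\<lambda>t. flow V t x)"
proof -
  obtain Y where "global_solution V x Y"
    using complete unfolding complete_field_def by blast
  then show ?thesis
    using flow_eq[of x Y] by simp
qed

lemma flow_0 [simp]: "flow V 0 x = x"
  using global_solution_flow[of x] by (simp add: global_solution_def)

lemma continuous_flow_time: "continuous_on S (\<lambda>t. flow V t x)"
  using global_solution_flow by (rule global_solution_continuous)

text \<open>The orbit of \<open>x\<close> shifted in time by \<open>t\<close> solves the equation
  with initial value \<open>flow V t x\<close>; uniqueness identifies it with the orbit of that
  point.\<close>

lemma flow_add: "flow V s (flow V t x) = flow V (s + t) x"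
  using flow_eq[OF global_solution_shift[OF global_solution_flow]] .

lemma flow_minus [simp]:
  "flow V (- t) (flow V t x) = x" "flow V t (flow V (- t) x) = x"
  by (simp_all add: flow_add)

text \<open>The locale assumptions are symmetric under changing the sign of the field, so results
  for nonnegative times become available for negative ones.\<close>

lemma reverse: "complete_lipschitz_field (\<lambda>y. - V y)"
proof
  show "\<exists>L. L-lipschitz_on (cball 0 R) (\<lambda>y. - V y)" for R
    using lipschitz[of R] lipschitz_on_minus by blast
  show "complete_field (\<lambda>y. - V y)"
    unfolding complete_field_def
    by (intro allI exI) (rule global_solution_reverse[OF global_solution_flow])
qed

lemma flow_reverse: "flow (\<lambda>y. - V y) t x = flow V (- t) x"
  using complete_lipschitz_field.flow_eq[OF reverse global_solution_reverse[OF global_solution_flow]] .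

text \<open>Points \<open>z\<close> close enough to \<open>x\<close> meet the smallness condition of
  the stability estimate, whose right-hand side tends to 0 as \<open>z\<close> tends to
  \<open>x\<close>.\<close>

lemma isCont_flow_nonneg:
  assumes "0 \<le> t"
  shows "isCont (flow V t) x"
proof -
  obtain L where L: "\<forall>z Z. global_solution V z Z \<longrightarrow> norm (z - x) * exp (L * t) < 1 \<longrightarrow>
      norm (Z t - flow V t x) \<le> norm (z - x) * exp (L * t)"
    using global_solutions_stay_close[OF lipschitz global_solution_flow assms] ..
  have lim: "((\<lambda>z. norm (z - x) * exp (L * t)) \<longlongrightarrow> 0) (at x)"
    by (auto intro!: tendsto_eq_intros)
  then have "\<forall>\<^sub>F z in at x. norm (z - x) * exp (L * t) < 1"
    by (rule order_tendstoD) simp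
  then have "\<forall>\<^sub>F z in at x. norm (flow V t z - flow V t x) \<le> norm (z - x) * exp (L * t)"
    by eventually_elim (rule L[rule_format, OF global_solution_flow])
  then have "((\<lambda>z. flow V t z - flow V t x) \<longlongrightarrow> 0) (at x)"
    using lim by (rule Lim_null_comparison)
  then show ?thesis
    using LIM_zero_cancel isCont_def by blast
qed

lemma continuous_flow: "continuous_on UNIV (flow V t)"
proof (cases "0 \<le> t")
  case True
  then show ?thesis
    using isCont_flow_nonneg by (simp add: continuous_on_eq_continuous_at)
next
  case False
  then have "isCont (flow (\<lambda>y. - V y) (- t)) x" for x
    using complete_lipschitz_field.isCont_flow_nonneg[OF reverse] by simp
  then have "isCont (flow V t) x" for x
    by (simp add: flow_reverse[abs_def])
  then show ?thesis
    by (simp add: continuous_on_eq_continuous_at)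
qed

text \<open>The continuous map \<open>flow V (- t)\<close> sends the moving domain back into
  \<open>\<Omega>\<close>, hence its closure into \<open>closure \<Omega>\<close>. This carries
  uniqueness, boundary points included, over to the moving domain.\<close>

lemma closure_moving_domain:
  assumes "y \<in> closure (moving_domain V \<Omega> t)"
  shows "flow V (- t) y \<in> closure \<Omega>"
proof -
  have "flow V (- t) ` closure (moving_domain V \<Omega> t) \<subseteq> closure \<Omega>"
  proof (rule image_closure_subset)
    show "flow V (- t) ` moving_domain V \<Omega> t \<subseteq> closure \<Omega>"
      using closure_subset by (fastforce simp: moving_domain_def)
  qed (auto intro: continuous_on_subset[OF continuous_flow])
  then show ?thesis
    using assms by blast
qed

end

section \<open>Linear scalar equations\<close>

text \<open>Variation of constants formula for the scalar problem \<open>u' + a u = h\<close>,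
  \<open>u 0 = c\<close>.\<close>

definition duhamel :: "(real \<Rightarrow> real) \<Rightarrow> (real \<Rightarrow> real) \<Rightarrow> real \<Rightarrow> real \<Rightarrow> real" where
  "duhamel a h c t =
     c * exp (- integral {0..t} a) + integral {0..t} (\<lambda>s. exp (- integral {s..t} a) * h s)"

lemma integral_has_real_derivative_atLeast:
  assumes "continuous_on {0..} g" "0 \<le> t"
  shows "((\<lambda>t. integral {0..t} g) has_real_derivative g t) (at t within {0..})"
proof -
  \<comment> \<open>The right end \<open>t + 1\<close> keeps \<open>t\<close> away from it, so the
    derivative within the compact interval is the one within the half-line; at \<open>t = 0\<close>
    both are one-sided.\<close>
  have "((\<lambda>t. integral {0..t} g) has_real_derivative g t) (at t within {0..t + 1})"
    using assms by (intro integral_has_real_derivative continuous_on_subset[OF assms(1)]) auto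
  moreover have "at t within {0..t + 1} = at t within {0..}"
    by (rule at_within_nhd[of t "{..<t + 1}"]) auto
  ultimately show ?thesis
    by simp
qed

context
  fixes a h :: "real \<Rightarrow> real"
  assumes a: "continuous_on {0..} a" and h: "continuous_on {0..} h"
begin

lemma continuous_on_integrating_factor:
  "continuous_on {0..} (\<lambda>t. exp (integral {0..t} a) * h t)"
proof (intro continuous_on_mult continuous_on_exp h)
  show "continuous_on {0..} (\<lambda>t. integral {0..t} a)"
    by (rule DERIV_continuous_on[OF integral_has_real_derivative_atLeast[OF a]]) simp
qed

text \<open>Splitting the integral of \<open>a\<close> over \<open>{0..t}\<close> at
  \<open>s\<close> factors the kernel and removes \<open>t\<close> from the integrand. The
  fundamental theorem of calculus then suffices for differentiating in \<open>t\<close>.\<close>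

lemma duhamel_integrating_factor:
  assumes "0 \<le> t"
  shows "duhamel a h c t =
    exp (- integral {0..t} a) * (c + integral {0..t} (\<lambda>s. exp (integral {0..s} a) * h s))"
proof -
  have "integral {0..s} a + integral {s..t} a = integral {0..t} a" if "s \<in> {0..t}" for s
    using that a by (intro Henstock_Kurzweil_Integration.integral_combine integrable_continuous_real)
      (auto intro: continuous_on_subset)
  then have "exp (- integral {s..t} a) * h s =
      exp (- integral {0..t} a) * (exp (integral {0..s} a) * h s)" if "s \<in> {0..t}" for s
    using that by (smt (verit) exp_add mult.assoc)
  then have "integral {0..t} (\<lambda>s. exp (- integral {s..t} a) * h s) =
      integral {0..t} (\<lambda>s. exp (- integral {0..t} a) * (exp (integral {0..s} a) * h s))"
    by (rule integral_cong)
  then show ?thesis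
    by (simp add: duhamel_def distrib_left)
qed

lemma duhamel_0: "duhamel a h c 0 = c"
  by (simp add: duhamel_def)

lemma duhamel_has_derivative:
  assumes "0 \<le> t"
  shows "(duhamel a h c has_real_derivative h t - duhamel a h c t * a t) (at t within {0..})"
proof -
  define A where "A t = integral {0..t} a" for t
  define G where "G t = integral {0..t} (\<lambda>s. exp (A s) * h s)" for t
  have eq: "duhamel a h c t = exp (- A t) * (c + G t)" if "0 \<le> t" for t
    using duhamel_integrating_factor[OF that] by (simp add: A_def G_def)
  have A: "(A has_real_derivative a t) (at t within {0..})"
    unfolding A_def by (rule integral_has_real_derivative_atLeast[OF a assms])
  have G: "(G has_real_derivative exp (A t) * h t) (at t within {0..})"
    unfolding G_def A_def
    by (rule integral_has_real_derivative_atLeast[OF continuous_on_integrating_factor assms])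
  have "((\<lambda>t. exp (- A t) * (c + G t)) has_real_derivative h t - duhamel a h c t * a t)
      (at t within {0..})"
    unfolding eq[OF assms]
    by (rule derivative_eq_intros refl A G)+ (simp add: exp_minus field_simps)
  \<comment> \<open>The factored form is known only for nonnegative times, which is enough for a
    derivative within the half-line.\<close>
  then show ?thesis
    by (rule has_field_derivative_transform_within[OF _ zero_less_one])
      (use assms in \<open>auto simp: eq\<close>)
qed

lemma duhamel_C1:
  "\<exists>T'. continuous_on {0..} T' \<and>
     (\<forall>t\<ge>0. (duhamel a h c has_real_derivative T' t) (at t within {0..}) \<and>
       T' t + duhamel a h c t * a t = h t)"
proof (intro exI[of _ "\<lambda>t. h t - duhamel a h c t * a t"] conjI allI impI)
  have "continuous_on {0..} (duhamel a h c)"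
    by (rule DERIV_continuous_on[OF duhamel_has_derivative]) simp
  then show "continuous_on {0..} (\<lambda>t. h t - duhamel a h c t * a t)"
    by (intro continuous_intros a h)
qed (use duhamel_has_derivative in auto)

text \<open>The difference of two solutions satisfies the homogeneous equation, so its product with
  the integrating factor has derivative 0 on the half-line and is constant; it vanishes at
  0.\<close>

lemma duhamel_unique:
  assumes S: "\<And>t. 0 \<le> t \<Longrightarrow> (S has_real_derivative h t - S t * a t) (at t within {0..})"
    and "0 \<le> t"
  shows "S t = duhamel a h (S 0) t"
proof -
  define A where "A t = integral {0..t} a" for t
  define U where "U = duhamel a h (S 0)"
  define D where "D t = (S t - U t) * exp (A t)" for t
  have "(D has_real_derivative 0) (at t within {0..})" if "t \<in> {0..}" for t
  proof -
    have "0 \<le> t"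
      using that by simp
    have A: "(A has_real_derivative a t) (at t within {0..})"
      unfolding A_def by (rule integral_has_real_derivative_atLeast[OF a \<open>0 \<le> t\<close>])
    have U: "(U has_real_derivative h t - U t * a t) (at t within {0..})"
      unfolding U_def by (rule duhamel_has_derivative[OF \<open>0 \<le> t\<close>])
    show ?thesis
      unfolding D_def
      by (rule derivative_eq_intros refl A U S[OF \<open>0 \<le> t\<close>])+ (simp add: algebra_simps)
  qed
  then obtain k where "\<And>t. t \<in> {0..} \<Longrightarrow> D t = k"
    using has_field_derivative_zero_constant[of "{0..}" D] by auto
  then have "D t = D 0"
    using \<open>0 \<le> t\<close> by simp
  then show ?thesis
    by (simp add: D_def U_def duhamel_0)
qed

end

section \<open>The two boundary value problems\<close>

text \<open>The equation is solved separately for each \<open>x\<close>. An open set is disjoint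
  from its frontier, and no continuity in \<open>x\<close> is demanded, so the boundary value 0
  never conflicts with the interior formula.\<close>

lemma fixed_domain_solution_duhamel:
  assumes "open \<Omega>"
    and a: "\<And>x. x \<in> \<Omega> \<Longrightarrow> continuous_on {0..} (a x)"
    and h: "\<And>x. x \<in> \<Omega> \<Longrightarrow> continuous_on {0..} (h x)"
  shows "fixed_domain_solution \<Omega> a h T0 (\<lambda>x t. if x \<in> \<Omega> then duhamel (a x) (h x) (T0 x) t else 0)"
  unfolding fixed_domain_solution_def
proof (intro conjI ballI allI impI)
  fix x assume "x \<in> \<Omega>"
  then show "\<exists>T'. continuous_on {0..} T' \<and>
      (\<forall>t\<ge>0. ((\<lambda>t. if x \<in> \<Omega> then duhamel (a x) (h x) (T0 x) t else 0) has_real_derivative T' t)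
          (at t within {0..}) \<and>
        T' t + (if x \<in> \<Omega> then duhamel (a x) (h x) (T0 x) t else 0) * a x t = h x t)"
    using duhamel_C1[OF a h] by simp
next
  fix x t assume "x \<in> frontier \<Omega>"
  then show "(if x \<in> \<Omega> then duhamel (a x) (h x) (T0 x) t else 0) = 0"
    using \<open>open \<Omega>\<close> frontier_disjoint_eq[of \<Omega>] by auto
qed (simp add: duhamel_def)

lemma fixed_domain_solution_unique:
  assumes a: "\<And>x. x \<in> \<Omega> \<Longrightarrow> continuous_on {0..} (a x)"
    and h: "\<And>x. x \<in> \<Omega> \<Longrightarrow> continuous_on {0..} (h x)"
    and S: "fixed_domain_solution \<Omega> a h T0 S"
    and x: "x \<in> closure \<Omega>" and t: "0 \<le> t"
  shows "S x t = (if x \<in> \<Omega> then duhamel (a x) (h x) (T0 x) t else 0)"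
proof (cases "x \<in> \<Omega>")
  case True
  obtain S' where S': "\<And>t. 0 \<le> t \<Longrightarrow> (S x has_real_derivative S' t) (at t within {0..})"
      "\<And>t. 0 \<le> t \<Longrightarrow> S' t + S x t * a x t = h x t"
    using S True unfolding fixed_domain_solution_def by blast
  have "(S x has_real_derivative h x t - S x t * a x t) (at t within {0..})" if "0 \<le> t" for t
  proof -
    have "S' t = h x t - S x t * a x t"
      using S'(2)[OF that] by simp
    then show ?thesis
      using S'(1)[OF that] by simp
  qed
  then have "S x t = duhamel (a x) (h x) (S x 0) t"
    using t by (rule duhamel_unique[OF a[OF True] h[OF True]])
  then show ?thesis
    using S True by (simp add: fixed_domain_solution_def)
next
  case False
  then show ?thesis
    using S x t by (simp add: fixed_domain_solution_def closure_Un_frontier)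
qed

theorem proposition5p1:
  fixes \<Omega>\<^sub>0 :: "(real ^ 'n) set"
    and V :: "real ^ 'n \<Rightarrow> real ^ 'n"
    and T0 :: "real ^ 'n \<Rightarrow> real"
    and f :: "real ^ 'n \<Rightarrow> real \<Rightarrow> real"
  assumes "smooth_open_set \<Omega>\<^sub>0"
    and "smooth_on UNIV V"
    and "complete_field V"
    and "smooth_on {(y, t). t \<ge> 0 \<and> y \<in> moving_domain V \<Omega>\<^sub>0 t} (\<lambda>(y, t). f y t)"
  shows
    "(\<exists>T. moving_domain_solution \<Omega>\<^sub>0 V f T0 T \<and>
        (\<forall>S. moving_domain_solution \<Omega>\<^sub>0 V f T0 S \<longrightarrow>
           (\<forall>t\<ge>0. \<forall>y\<in>closure (moving_domain V \<Omega>\<^sub>0 t). S y t = T y t)) \<and>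
        (\<forall>t\<ge>0. \<forall>y\<in>moving_domain V \<Omega>\<^sub>0 t. \<forall>x\<in>\<Omega>\<^sub>0. y = flow V t x \<longrightarrow>
           T y t = T0 x * exp (- integral {0..t} (\<lambda>r. divergence V (flow V r x)))
             + integral {0..t} (\<lambda>s. exp (- integral {s..t} (\<lambda>r. divergence V (flow V r x)))
                                     * f (flow V s x) s)))
     \<and>
     (\<exists>T. fixed_domain_solution \<Omega>\<^sub>0 (pullback V (\<lambda>y t. divergence V y)) (pullback V f) T0 T \<and>
        (\<forall>S. fixed_domain_solution \<Omega>\<^sub>0 (pullback V (\<lambda>y t. divergence V y)) (pullback V f) T0 S \<longrightarrow>
           (\<forall>t\<ge>0. \<forall>x\<in>closure \<Omega>\<^sub>0. S x t = T x t)) \<and>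
        (\<forall>t\<ge>0. \<forall>x\<in>\<Omega>\<^sub>0.
           T x t = T0 x * exp (- integral {0..t} (\<lambda>r. divergence V (flow V r x)))
             + integral {0..t} (\<lambda>s. exp (- integral {s..t} (\<lambda>r. divergence V (flow V r x)))
                                     * pullback V f x s)))"
proof -
  interpret complete_lipschitz_field V
    using smooth_on_UNIV_imp_lipschitz_on_cball[OF assms(2)] assms(3)
    by unfold_locales
  have \<Omega>: "open \<Omega>\<^sub>0"
    using assms(1) by (simp add: smooth_open_set_def)
  define a where "a = pullback V (\<lambda>y t. divergence V y)"
  define h where "h = pullback V f"
  have a: "continuous_on {0..} (a x)" for x
    unfolding a_def pullback_def
    using continuous_on_compose2[OF smooth_on_UNIV_imp_continuous_divergence[OF assms(2)]
        continuous_flow_time] by simp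
  \<comment> \<open>Only for \<open>x\<close> in \<open>\<Omega>\<^sub>0\<close> does the curve of
    points \<open>(flow V t x, t)\<close> stay in the set where \<open>f\<close> is smooth.\<close>
  have h: "continuous_on {0..} (h x)" if "x \<in> \<Omega>\<^sub>0" for x
  proof -
    have "continuous_on {0..} (\<lambda>t. (\<lambda>(y, t). f y t) (flow V t x, t))"
      by (rule continuous_on_compose2[OF smooth_on_imp_continuous_on[OF assms(4)]])
        (use that in \<open>auto simp: moving_domain_def intro!: continuous_intros continuous_flow_time\<close>)
    then show ?thesis
      by (simp add: h_def pullback_def)
  qed
  \<comment> \<open>The value 0 is the boundary condition on the frontier and a mere default outside
    the closure.\<close>
  define T where "T x t = (if x \<in> \<Omega>\<^sub>0 then duhamel (a x) (h x) (T0 x) t else 0)" for x t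
  have T: "fixed_domain_solution \<Omega>\<^sub>0 a h T0 T"
    using fixed_domain_solution_duhamel[OF \<Omega> a h] unfolding T_def[abs_def] .
  have unique: "S x t = T x t"
    if "fixed_domain_solution \<Omega>\<^sub>0 a h T0 S" "0 \<le> t" "x \<in> closure \<Omega>\<^sub>0" for S x t
    using fixed_domain_solution_unique[OF a h that(1,3,2)] unfolding T_def .
  have formula: "T x t = T0 x * exp (- integral {0..t} (\<lambda>r. divergence V (flow V r x)))
      + integral {0..t} (\<lambda>s. exp (- integral {s..t} (\<lambda>r. divergence V (flow V r x)))
          * pullback V f x s)" if "x \<in> \<Omega>\<^sub>0" for x t
    using that by (simp add: T_def duhamel_def a_def h_def pullback_def[abs_def])
  \<comment> \<open>\<open>M\<close> is \<open>T\<close> transported by the inverse flow, so its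
    pull-back is exactly \<open>T\<close> and existence carries over.\<close>
  define M where "M y t = T (flow V (- t) y) t" for y t
  have M: "pullback V M = T"
    by (simp add: fun_eq_iff pullback_def M_def)
  \<comment> \<open>The value of \<open>S\<close> at \<open>y\<close> is that of its pull-back at
    \<open>flow V (- t) y\<close>, a point of \<open>closure \<Omega>\<^sub>0\<close>, where
    fixed-domain uniqueness applies.\<close>
  have M_unique: "S y t = M y t"
    if "moving_domain_solution \<Omega>\<^sub>0 V f T0 S" "0 \<le> t" "y \<in> closure (moving_domain V \<Omega>\<^sub>0 t)" for S y t
    using unique[of "pullback V S" t "flow V (- t) y"] closure_moving_domain[OF that(3)] that
    by (simp add: moving_domain_solution_def a_def h_def M_def pullback_def)
  show ?thesis
  proof (rule conjI[OF exI[of _ M] exI[of _ T]]; intro conjI allI impI ballI)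
    show "moving_domain_solution \<Omega>\<^sub>0 V f T0 M"
      using T by (simp add: moving_domain_solution_def M a_def h_def)
    show "fixed_domain_solution \<Omega>\<^sub>0 (pullback V (\<lambda>y t. divergence V y)) (pullback V f) T0 T"
      using T by (simp add: a_def h_def)
  next
    fix t y x assume "x \<in> \<Omega>\<^sub>0" "y = flow V t x"
    then show "M y t = T0 x * exp (- integral {0..t} (\<lambda>r. divergence V (flow V r x)))
        + integral {0..t} (\<lambda>s. exp (- integral {s..t} (\<lambda>r. divergence V (flow V r x)))
            * f (flow V s x) s)"
      using formula by (simp add: M_def pullback_def)
  qed (use M_unique unique formula in \<open>auto simp: a_def h_def\<close>)
qed

end
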